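(* Let $d \ge 2$ be an integer, let $(P,H,I)$ be an incidence geometry satisfying $|I| = d|P|+|H|-d$, let $p \in P$, and let $X$ be a $d\times |H|$ matrix of indeterminates (with columns indexed by $H$). Then $\det(M_X^p(P,H,I))$ is a bracket polynomial in $\mathbb{R}[X]$.
   Context: An incidence geometry is a triple $(P,H,I)$ where $P$ is a finite set (of points), $H$ is a finite set (of hyperplanes) and $I \subseteq P\times H$ is an arbitrary subset (of incidences). Given a $d\times |H|$ matrix $S$ with columns $S_h$ indexed by $h\in H$ (entries real numbers or indeterminates), $M_S(P,H,I)$ is the $|I|\times(|H|+d|P|)$ matrix whose rows are indexed by $I$ and whose columns are as follows: each $h\in H$ indexes one column and each $p\in P$ indexes a block of $d$ columns. The row of the incidence $(p,h)\in I$ has entry $1$ in the column of $h$, has the $d$ entries of $S_h$ in the $d$ columns of $p$ (in order), and is zero elsewhere; i.e. it is the coefficient vector of the linear functional $(x,y)\mapsto \langle S_h, x_p\rangle + y_h$ with $x_p\in\mathbb{R}^d$, $y_h\in\mathbb{R}$. For $p\in P$, the pinned matrix $M_S^p(P,H,I)$ is obtained from $M_S(P,H,I)$ by adding, for each of the $d$ columns indexed by $p$, one new row that is zero except for a $1$ in that column. It has size $(|I|+d)\times(|H|+d|P|)$, hence is square when $|I| = d|P|+|H|-d$. Orderings of rows and columns are fixed once and for all. $\mathbb{R}[X]$ denotes the polynomial ring over $\mathbb{R}$ in the entries of $X$. A bracket is the determinant of a $d\times d$ submatrix of $X$ obtained by choosing $d$ distinct columns. A bracket polynomial is an element of the $\mathbb{R}$-subalgebra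 of $\mathbb{R}[X]$ generated by all brackets (if $|H|<d$ there are no brackets and this subalgebra is $\mathbb{R}$). *)

theory Defs
  imports
    "HOL-Library.Poly_Mapping"
    "Jordan_Normal_Form.Determinant"
begin

definition incidence_geometry :: "'p set \<Rightarrow> 'h set \<Rightarrow> ('p \<times> 'h) set \<Rightarrow> bool" where
  "incidence_geometry P H I \<longleftrightarrow> finite P \<and> finite H \<and> I \<subseteq> P \<times> H"


text \<open>
  The matrices are first given as functions of abstract row and column labels. The column labels
  are \<open>Inl h\<close> for a hyperplane \<open>h\<close> and \<open>Inr (p, k)\<close> with \<open>k < d\<close> for the \<open>k\<close>-th column in the block
  of the point \<open>p\<close>. A \<open>d \<times> |H|\<close> matrix \<open>S\<close> is a function with entries \<open>S k h\<close>, where \<open>k < d\<close> and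
  \<open>h \<in> H\<close>. The row labels of the pinned matrix are \<open>Inl (p, h)\<close> for an incidence and \<open>Inr k\<close> with
  \<open>k < d\<close> for the row that pins the \<open>k\<close>-th coordinate of the point.
\<close>

definition column_labels :: "nat \<Rightarrow> 'p set \<Rightarrow> 'h set \<Rightarrow> ('h + 'p \<times> nat) set" where
  "column_labels d P H = H <+> (P \<times> {..<d})"

definition pinned_row_labels :: "nat \<Rightarrow> ('p \<times> 'h) set \<Rightarrow> (('p \<times> 'h) + nat) set" where
  "pinned_row_labels d I = I <+> {..<d}"

fun M_entry :: "(nat \<Rightarrow> 'h \<Rightarrow> 'a::zero_neq_one) \<Rightarrow> 'p \<times> 'h \<Rightarrow> 'h + 'p \<times> nat \<Rightarrow> 'a" where
  "M_entry S (p, h) (Inl h') = (if h' = h then 1 else 0)"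
| "M_entry S (p, h) (Inr (p', k)) = (if p' = p then S k h else 0)"

fun M_pinned_entry ::
  "(nat \<Rightarrow> 'h \<Rightarrow> 'a::zero_neq_one) \<Rightarrow> 'p \<Rightarrow> ('p \<times> 'h) + nat \<Rightarrow> 'h + 'p \<times> nat \<Rightarrow> 'a" where
  "M_pinned_entry S p (Inl i) c = M_entry S i c"
| "M_pinned_entry S p (Inr k) c = (if c = Inr (p, k) then 1 else 0)"

definition enumerates :: "'b list \<Rightarrow> 'b set \<Rightarrow> bool" where
  "enumerates xs A \<longleftrightarrow> distinct xs \<and> set xs = A"

definition ordered_matrix :: "'r list \<Rightarrow> 'c list \<Rightarrow> ('r \<Rightarrow> 'c \<Rightarrow> 'a) \<Rightarrow> 'a mat" where
  "ordered_matrix rs cs f = mat (length rs) (length cs) (\<lambda>(i, j). f (rs ! i) (cs ! j))"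

definition M_pinned_matrix ::
  "(nat \<Rightarrow> 'h \<Rightarrow> 'a::zero_neq_one) \<Rightarrow> 'p \<Rightarrow> (('p \<times> 'h) + nat) list \<Rightarrow> ('h + 'p \<times> nat) list \<Rightarrow> 'a mat" where
  "M_pinned_matrix S p rs cs = ordered_matrix rs cs (M_pinned_entry S p)"


text \<open>
  Real polynomials in indeterminates \<open>x\<^sub>k\<^sub>h\<close>, as finitely supported functions from monomials
  (exponent vectors) to coefficients. The ring has an indeterminate for every natural number \<open>k\<close>
  and every \<open>h\<close> in the type; \<open>\<real>[X]\<close> for a \<open>d \<times> |H|\<close> matrix \<open>X\<close> is the subring of the polynomials
  in which only indeterminates with \<open>k < d\<close> and \<open>h \<in> H\<close> occur.
\<close>

type_synonym 'h real_mpoly = "(nat \<times> 'h \<Rightarrow>\<^sub>0 nat) \<Rightarrow>\<^sub>0 real"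

definition const_poly :: "real \<Rightarrow> 'h real_mpoly" where
  "const_poly c = Poly_Mapping.single 0 c"

definition indet :: "nat \<Rightarrow> 'h \<Rightarrow> 'h real_mpoly" where
  "indet k h = Poly_Mapping.single (Poly_Mapping.single (k, h) 1) 1"

inductive_set subalgebra_generated :: "'h real_mpoly set \<Rightarrow> 'h real_mpoly set"
  for B :: "'h real_mpoly set" where
  const: "const_poly c \<in> subalgebra_generated B"
| gen: "b \<in> B \<Longrightarrow> b \<in> subalgebra_generated B"
| add: "f \<in> subalgebra_generated B \<Longrightarrow> g \<in> subalgebra_generated B \<Longrightarrow> f + g \<in> subalgebra_generated B"
| mult: "f \<in> subalgebra_generated B \<Longrightarrow> g \<in> subalgebra_generated B \<Longrightarrow> f * g \<in> subalgebra_generated B"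

text \<open>
  The chosen columns may be listed in any order. This changes a bracket at most by a sign, so the
  subalgebra generated by the brackets does not depend on an ordering of \<open>H\<close>.
\<close>

definition bracket :: "nat \<Rightarrow> 'h list \<Rightarrow> 'h real_mpoly" where
  "bracket d hs = det (mat d d (\<lambda>(i, j). indet i (hs ! j)))"

definition brackets :: "nat \<Rightarrow> 'h set \<Rightarrow> 'h real_mpoly set" where
  "brackets d H = {bracket d hs | hs. length hs = d \<and> distinct hs \<and> set hs \<subseteq> H}"

definition bracket_polynomials :: "nat \<Rightarrow> 'h set \<Rightarrow> 'h real_mpoly set" where
  "bracket_polynomials d H = subalgebra_generated (brackets d H)"

end

theory Submission
  imports Defs
begin

text \<open>
  The rows that pin \<open>p\<close> are unit vectors in the block of \<open>p\<close>, so only those terms of the Leibniz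
  expansion survive that match them with the columns of \<open>p\<close>. What remains are the columns of the
  hyperplanes, whose entries are \<open>0\<close> or \<open>1\<close>, and one block of \<open>d\<close> columns for each point
  \<open>q \<noteq> p\<close>. A generalized Laplace expansion along these blocks writes the determinant as a sum of
  products of integers and of \<open>d \<times> d\<close> minors, one inside each block. Such a minor vanishes if one
  of its rows is not an incidence of \<open>q\<close>. Otherwise its rows are the transposed columns
  \<open>X\<^sub>h\<close> for \<open>d\<close> different hyperplanes \<open>h\<close> incident with \<open>q\<close>, so that it is a
  bracket. Hence the determinant is an explicit polynomial in brackets.

  Since \<open>\<real>[X]\<close> contains the rationals, the Laplace expansion is replaced by an averaged form, lemma
  \<open>label_det_block_average\<close>. It sums over all permutations instead of over the ways to distribute
  rows to blocks, so that every product of minors is counted \<open>d!\<close> times for each block; these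
  factors are cancelled at the end. That each summand is a bracket polynomial is lemma
  \<open>expansion_term_bracket_polynomial\<close>.
\<close>

section \<open>Determinants over label sets and block averaging\<close>

text \<open>
  The Leibniz formula over an arbitrary finite label set that serves for rows and columns alike. It
  spares the blocks of columns, which are scattered in the given enumeration of all columns, a
  renumbering.
\<close>
definition label_det :: "'c set \<Rightarrow> ('c \<Rightarrow> 'c \<Rightarrow> 'a::comm_ring_1) \<Rightarrow> 'a" where
  "label_det C A = (\<Sum>\<sigma> | \<sigma> permutes C. of_int (sign \<sigma>) * (\<Prod>c\<in>C. A (\<sigma> c) c))"

lemma det_eq_label_det:
  fixes A :: "'c \<Rightarrow> 'c \<Rightarrow> 'a::comm_ring_1"
  assumes e: "bij_betw e {0..<n} C"
  shows "det (mat n n (\<lambda>(i, j). A (e i) (e j))) = label_det C A"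
proof -
  have inj: "inj_on e {0..<n}" using e by (simp add: bij_betw_def)
  have "det (mat n n (\<lambda>(i, j). A (e i) (e j))) =
      (\<Sum>\<pi> | \<pi> permutes {0..<n}. of_int (sign \<pi>) * (\<Prod>j<n. A (e (\<pi> j)) (e j)))"
  proof (subst det_col[where n = n], simp, intro sum.cong prod.cong refl arg_cong2[where f = "(*)"])
    fix \<pi> j assume "\<pi> \<in> {\<pi>. \<pi> permutes {0..<n}}" "j \<in> {..<n}"
    then have "\<pi> j < n" "j < n" using permutes_in_image[of \<pi> "{0..<n}" j] by auto
    then show "mat n n (\<lambda>(i, j). A (e i) (e j)) $$ (\<pi> j, j) = A (e (\<pi> j)) (e j)" by simp
  qed
  also have "\<dots> = label_det C A"
    unfolding label_det_def
  proof (rule sum.reindex_bij_witness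
      [where j = "map_permutation {0..<n} e"
        and i = "map_permutation C (inv_into {0..<n} e)"]; (simp only: mem_Collect_eq)?)
    fix \<pi> assume pi: "\<pi> permutes {0..<n}"
    show "map_permutation C (inv_into {0..<n} e) (map_permutation {0..<n} e \<pi>) = \<pi>"
      by (rule map_permutation_compose_inv[OF e pi]) (simp add: inj)
    show "map_permutation {0..<n} e \<pi> permutes C"
      by (rule map_permutation_permutes[OF e pi])
    have "(\<Prod>c\<in>C. A (map_permutation {0..<n} e \<pi> c) c) =
        (\<Prod>j\<in>{0..<n}. A (map_permutation {0..<n} e \<pi> (e j)) (e j))"
      by (rule prod.reindex_bij_betw[OF e, symmetric])
    also have "\<dots> = (\<Prod>j<n. A (e (\<pi> j)) (e j))"
      by (rule prod.cong) (auto simp: map_permutation_apply[OF inj])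
    finally show "of_int (sign (map_permutation {0..<n} e \<pi>)) *
        (\<Prod>c\<in>C. A (map_permutation {0..<n} e \<pi> c) c) =
        of_int (sign \<pi>) * (\<Prod>j<n. A (e (\<pi> j)) (e j))"
      by (simp add: sign_map_permutation[OF inj pi])
  next
    fix \<sigma> assume si: "\<sigma> permutes C"
    show "map_permutation {0..<n} e (map_permutation C (inv_into {0..<n} e) \<sigma>) = \<sigma>"
      by (rule map_permutation_compose_inv[OF bij_betw_inv_into[OF e] si])
        (use bij_betw_inv_into_right[OF e] in auto)
    show "map_permutation C (inv_into {0..<n} e) \<sigma> permutes {0..<n}"
      by (rule map_permutation_permutes[OF bij_betw_inv_into[OF e] si])
  qed
  finally show ?thesis .
qed

text \<open>
  Laplace expansion along the blocks of columns \<open>B q\<close>, averaged over the permutations inside the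
  blocks. The columns outside all blocks are expanded entry by entry. One block is split off at a
  time: replacing \<open>\<sigma>\<close> by \<open>\<sigma> \<circ> g\<close>, for a permutation \<open>g\<close> of the block, permutes the
  summands, changes nothing outside the block, and the sum over all \<open>g\<close> turns the product of the
  entries in the block into a minor.
\<close>
lemma label_det_block_average:
  fixes A :: "'c \<Rightarrow> 'c \<Rightarrow> 'a::comm_ring_1"
  assumes "finite C" "finite Q" "disjoint_family_on B Q" "(\<Union>q\<in>Q. B q) \<subseteq> C"
  shows "(\<Prod>q\<in>Q. of_nat (fact (card (B q)))) * label_det C A =
    (\<Sum>\<sigma> | \<sigma> permutes C. of_int (sign \<sigma>) *
      ((\<Prod>q\<in>Q. label_det (B q) (\<lambda>i. A (\<sigma> i))) * (\<Prod>c\<in>C - (\<Union>q\<in>Q. B q). A (\<sigma> c) c)))"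
  using assms(2-4)
proof (induction Q rule: finite_induct)
  case empty
  then show ?case by (simp add: label_det_def)
next
  case (insert b Q)
  let ?U = "\<Union>q\<in>Q. B q"
  let ?S = "{\<sigma>. \<sigma> permutes C}"
  define W where "W \<sigma> = (\<Prod>q\<in>Q. label_det (B q) (\<lambda>i. A (\<sigma> i)))" for \<sigma>
  define F where "F \<sigma> = of_int (sign \<sigma>) * (W \<sigma> * (\<Prod>c\<in>C - ?U. A (\<sigma> c) c))" for \<sigma>
  have IH: "(\<Prod>q\<in>Q. of_nat (fact (card (B q)))) * label_det C A = sum F ?S"
    unfolding F_def W_def
    by (rule insert.IH) (use insert.prems in \<open>auto simp: disjoint_family_on_def\<close>)
  have dis: "B b \<inter> B q = {}" if "q \<in> Q" for q
    using insert.prems(1) insert.hyps that by (auto simp: disjoint_family_on_def)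
  have finb: "finite (B b)" and bC: "B b \<subseteq> C"
    using insert.prems assms(1) finite_subset by auto
  \<comment> \<open>\<open>g\<close> fixes all labels outside \<open>B b\<close>, so it leaves the minors of the other blocks alone.\<close>
  have compose: "F (\<sigma> \<circ> g) = of_int (sign \<sigma>) * (W \<sigma> *
      (of_int (sign g) * (\<Prod>c\<in>B b. A (\<sigma> (g c)) c)) * (\<Prod>c\<in>C - ?U - B b. A (\<sigma> c) c))"
    if s: "\<sigma> permutes C" and g: "g permutes B b" for \<sigma> g
  proof -
    have gid: "g c = c" if "c \<notin> B b" for c
      using g that by (simp add: permutes_def)
    have sgn: "sign (\<sigma> \<circ> g) = sign \<sigma> * sign g"
      by (rule sign_compose) (use s g assms(1) finb in \<open>auto simp: permutation_permutes\<close>)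
    have "W (\<sigma> \<circ> g) = W \<sigma>"
      unfolding W_def label_det_def
    proof (intro prod.cong sum.cong refl arg_cong2[where f = "(*)"])
      fix q h c assume "q \<in> Q" "h \<in> {h. h permutes B q}" "c \<in> B q"
      then have "h c \<in> B q" by (simp add: permutes_in_image)
      then have "g (h c) = h c"
        using dis[OF \<open>q \<in> Q\<close>] by (intro gid) auto
      then show "A ((\<sigma> \<circ> g) (h c)) c = A (\<sigma> (h c)) c" by simp
    qed
    moreover have "(\<Prod>c\<in>C - ?U. A ((\<sigma> \<circ> g) c) c) =
        (\<Prod>c\<in>C - ?U - B b. A (\<sigma> c) c) * (\<Prod>c\<in>B b. A (\<sigma> (g c)) c)"
    proof -
      have "B b \<subseteq> C - ?U" using bC dis by auto
      then have "(\<Prod>c\<in>C - ?U. A ((\<sigma> \<circ> g) c) c) =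
        (\<Prod>c\<in>C - ?U - B b. A ((\<sigma> \<circ> g) c) c) * (\<Prod>c\<in>B b. A ((\<sigma> \<circ> g) c) c)"
        by (rule prod.subset_diff) (simp add: assms(1))
      moreover have "(\<Prod>c\<in>C - ?U - B b. A ((\<sigma> \<circ> g) c) c) = (\<Prod>c\<in>C - ?U - B b. A (\<sigma> c) c)"
        by (rule prod.cong) (auto simp: gid)
      ultimately show ?thesis by simp
    qed
    ultimately show ?thesis
      by (simp add: F_def sgn mult_ac)
  qed
  have "of_nat (fact (card (B b))) * sum F ?S = (\<Sum>g | g permutes B b. sum F ?S)"
    by (simp add: card_permutations[OF refl finb])
  also have "\<dots> = (\<Sum>g | g permutes B b. \<Sum>\<sigma> | \<sigma> permutes C. F (\<sigma> \<circ> g))"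
    by (rule sum.cong[OF refl], rule sum_permutations_compose_right)
      (use permutes_subset[OF _ bC] in simp)
  also have "\<dots> = (\<Sum>\<sigma> | \<sigma> permutes C. \<Sum>g | g permutes B b. F (\<sigma> \<circ> g))"
    by (rule sum.swap)
  also have "\<dots> = (\<Sum>\<sigma> | \<sigma> permutes C. of_int (sign \<sigma>) *
      (W \<sigma> * label_det (B b) (\<lambda>i. A (\<sigma> i)) * (\<Prod>c\<in>C - ?U - B b. A (\<sigma> c) c)))"
    (is "_ = ?avg")
  proof (rule sum.cong[OF refl])
    fix \<sigma> assume "\<sigma> \<in> ?S"
    then have "(\<Sum>g | g permutes B b. F (\<sigma> \<circ> g)) = (\<Sum>g | g permutes B b.
        of_int (sign \<sigma>) * (W \<sigma> * (of_int (sign g) * (\<Prod>c\<in>B b. A (\<sigma> (g c)) c)) *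
          (\<Prod>c\<in>C - ?U - B b. A (\<sigma> c) c)))"
      by (intro sum.cong refl compose) simp_all
    then show "(\<Sum>g | g permutes B b. F (\<sigma> \<circ> g)) = of_int (sign \<sigma>) *
        (W \<sigma> * label_det (B b) (\<lambda>i. A (\<sigma> i)) * (\<Prod>c\<in>C - ?U - B b. A (\<sigma> c) c))"
      by (simp only: label_det_def sum_distrib_left sum_distrib_right)
  qed
  finally have "of_nat (fact (card (B b))) * sum F ?S = ?avg" .
  moreover have "(\<Prod>q\<in>insert b Q. of_nat (fact (card (B q)))) * label_det C A =
      of_nat (fact (card (B b))) * sum F ?S"
    by (simp only: prod.insert[OF insert.hyps] mult.assoc IH)
  moreover have "C - ?U - B b = C - (\<Union>q\<in>insert b Q. B q)" by auto
  moreover have "(\<Prod>q\<in>insert b Q. label_det (B q) (\<lambda>i. A (\<sigma> i))) =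
      W \<sigma> * label_det (B b) (\<lambda>i. A (\<sigma> i))" for \<sigma>
    by (simp only: prod.insert[OF insert.hyps] W_def mult.commute)
  ultimately show ?case
    by (simp only:)
qed

lemma label_det_zero_row:
  assumes "finite C" "i \<in> C" "\<And>c. c \<in> C \<Longrightarrow> A i c = 0"
  shows "label_det C A = 0"
  unfolding label_det_def
proof (rule sum.neutral, rule ballI)
  fix \<sigma> assume "\<sigma> \<in> {\<sigma>. \<sigma> permutes C}"
  then have s: "\<sigma> permutes C" by simp
  have "i \<in> \<sigma> ` C" using assms(2) by (simp add: permutes_image[OF s])
  then obtain c where c: "c \<in> C" "\<sigma> c = i" by (elim imageE) simp
  then have "A (\<sigma> c) c = 0" using assms(3) by simp
  then have "(\<Prod>c\<in>C. A (\<sigma> c) c) = 0"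
    using assms(1) c(1) by (intro prod_zero bexI[of _ c])
  then show "of_int (sign \<sigma>) * (\<Prod>c\<in>C. A (\<sigma> c) c) = 0" by simp
qed


section \<open>Generated subalgebras\<close>

lemma const_poly_of_nat: "const_poly (of_nat n) = of_nat n"
  by (simp add: const_poly_def)

lemma const_poly_mult: "const_poly (a * b) = const_poly a * const_poly b"
  by (simp add: const_poly_def mult_single)

lemma subalgebra_of_int: "of_int z \<in> subalgebra_generated B"
proof -
  have "const_poly (of_int z) = of_int z"
  proof (cases z)
    case (nonneg n)
    then show ?thesis by (simp add: const_poly_def)
  next
    case (neg n)
    have "const_poly (- real (Suc n)) = - of_nat (Suc n)"
      by (simp add: const_poly_def single_uminus[symmetric] flip: single_of_nat)
    then show ?thesis using neg by simp
  qed
  then show ?thesis using subalgebra_generated.const by metis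
qed

lemma subalgebra_0: "0 \<in> subalgebra_generated B"
  and subalgebra_1: "1 \<in> subalgebra_generated B"
  using subalgebra_of_int[of 0] subalgebra_of_int[of 1] by simp_all

lemma subalgebra_sum:
  "(\<And>x. x \<in> X \<Longrightarrow> f x \<in> subalgebra_generated B) \<Longrightarrow> sum f X \<in> subalgebra_generated B"
  by (induction X rule: infinite_finite_induct)
    (auto intro: subalgebra_0 subalgebra_generated.add)

lemma subalgebra_prod:
  "(\<And>x. x \<in> X \<Longrightarrow> f x \<in> subalgebra_generated B) \<Longrightarrow> prod f X \<in> subalgebra_generated B"
  by (induction X rule: infinite_finite_induct)
    (auto intro: subalgebra_1 subalgebra_generated.mult)

lemma subalgebra_cancel_of_nat:
  assumes "of_nat m * f \<in> subalgebra_generated B" "m > 0"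
  shows "f \<in> subalgebra_generated B"
proof -
  have "const_poly (1 / real m) * (of_nat m * f) = const_poly (1 / real m * real m) * f"
    by (simp only: const_poly_mult const_poly_of_nat mult.assoc)
  also have "\<dots> = f" using assms(2) by (simp add: const_poly_def)
  finally show ?thesis
    using subalgebra_generated.mult[OF subalgebra_generated.const assms(1)] by metis
qed


section \<open>The pinned matrix\<close>

definition block :: "nat \<Rightarrow> 'p \<Rightarrow> ('h + 'p \<times> nat) set" where
  "block d q = (\<lambda>k. Inr (q, k)) ` {0..<d}"

lemma bij_block: "bij_betw (\<lambda>k. Inr (q, k)) {0..<d} (block d q)"
  by (auto simp: block_def bij_betw_def inj_on_def)

text \<open>
  A minor inside the block of a point \<open>q \<noteq> p\<close> is zero or a bracket. The injection \<open>\<tau>\<close> tells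
  which rows of the pinned matrix the minor uses. A pinning row and an incidence of another
  point are zero in this block, and different incidences of \<open>q\<close> have different hyperplanes.
\<close>
lemma block_label_det:
  fixes \<tau> :: "'h + 'p \<times> nat \<Rightarrow> ('p \<times> 'h) + nat"
  assumes inj: "inj_on \<tau> (block d q)"
    and rows: "\<tau> ` block d q \<subseteq> pinned_row_labels d I" and I: "I \<subseteq> P \<times> H" and "q \<noteq> p"
  shows "label_det (block d q) (\<lambda>i. M_pinned_entry indet p (\<tau> i)) \<in> bracket_polynomials d H"
proof (cases "\<forall>i\<in>block d q. \<exists>h. \<tau> i = Inl (q, h)")
  case False
  then obtain i where i: "i \<in> block d q" "\<And>h. \<tau> i \<noteq> Inl (q, h)" by blast
  have "M_pinned_entry indet p (\<tau> i) c = (0 :: 'h real_mpoly)" if "c \<in> block d q" for c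
  proof (cases "\<tau> i")
    case (Inl a)
    then have "fst a \<noteq> q" using i(2) by (cases a) auto
    then show ?thesis using Inl that by (cases a) (auto simp: block_def)
  next
    case (Inr k)
    then show ?thesis using that \<open>q \<noteq> p\<close> by (auto simp: block_def)
  qed
  then have "label_det (block d q) (\<lambda>i. M_pinned_entry indet p (\<tau> i)) = (0 :: 'h real_mpoly)"
    using i(1) by (intro label_det_zero_row) (auto simp: block_def)
  then show ?thesis by (simp add: bracket_polynomials_def subalgebra_0)
next
  case True
  then have "\<forall>k. \<exists>h. k < d \<longrightarrow> \<tau> (Inr (q, k)) = Inl (q, h)"
    by (auto simp: block_def)
  from choice[OF this] obtain h where h: "\<And>k. k < d \<Longrightarrow> \<tau> (Inr (q, k)) = Inl (q, h k)"
    by blast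
  define hs where "hs = map h [0..<d]"
  have "inj_on h {0..<d}"
  proof (rule inj_onI)
    fix k l assume kl: "k \<in> {0..<d}" "l \<in> {0..<d}" "h k = h l"
    then have "\<tau> (Inr (q, k)) = \<tau> (Inr (q, l))" by (simp add: h)
    then show "k = l" using inj kl by (auto simp: block_def inj_on_def)
  qed
  then have "distinct hs" by (simp add: hs_def distinct_map)
  moreover have "set hs \<subseteq> H"
  proof
    fix x assume "x \<in> set hs"
    then obtain k where k: "k < d" "x = h k" by (auto simp: hs_def)
    then have "Inl (q, x) \<in> pinned_row_labels d I"
      using rows h[of k] by (force simp: block_def)
    then show "x \<in> H" using I by (auto simp: pinned_row_labels_def)
  qed
  moreover have "length hs = d" by (simp add: hs_def)
  ultimately have "bracket d hs \<in> brackets d H"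
    unfolding brackets_def by blast
  moreover have "label_det (block d q) (\<lambda>i. M_pinned_entry indet p (\<tau> i)) = bracket d hs"
  proof -
    have "label_det (block d q) (\<lambda>i. M_pinned_entry indet p (\<tau> i)) =
        det (mat d d (\<lambda>(i, j). M_pinned_entry indet p (\<tau> (Inr (q, i))) (Inr (q, j))) :: 'h real_mpoly mat)"
      by (rule det_eq_label_det[OF bij_block, symmetric])
    also have "mat d d (\<lambda>(i, j). M_pinned_entry indet p (\<tau> (Inr (q, i))) (Inr (q, j))) =
        transpose_mat (mat d d (\<lambda>(i, j). indet i (hs ! j)))"
      by (rule eq_matI) (auto simp: h hs_def)
    also have "det \<dots> = bracket d hs"
      unfolding bracket_def by (rule det_transpose[of _ d]) simp
    finally show ?thesis .
  qed
  ultimately show ?thesis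
    by (simp add: bracket_polynomials_def subalgebra_generated.gen)
qed

text \<open>
  The block of \<open>p\<close> is not among the blocks whose minors are taken, because a minor there can mix
  pinning rows with incidences of \<open>p\<close> and need not be a bracket. If \<open>\<tau>\<close> matches each pinning row
  with its own column, this block contributes only factors \<open>1\<close>. Otherwise some pinning row is
  used for a column in which it is zero, and it kills either the minor or the single entry in
  which it occurs.
\<close>
lemma expansion_term_bracket_polynomial:
  fixes \<tau> :: "'h + 'p \<times> nat \<Rightarrow> ('p \<times> 'h) + nat"
  assumes \<tau>: "bij_betw \<tau> (column_labels d P H) (pinned_row_labels d I)"
    and fin: "finite P" "finite H" and I: "I \<subseteq> P \<times> H" and p: "p \<in> P"
  shows "(\<Prod>q\<in>P - {p}. label_det (block d q) (\<lambda>i. M_pinned_entry indet p (\<tau> i))) *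
    (\<Prod>c\<in>column_labels d P H - (\<Union>q\<in>P - {p}. block d q). M_pinned_entry indet p (\<tau> c) c)
      \<in> bracket_polynomials d H" (is "?D * ?E \<in> _")
proof -
  have rest: "column_labels d P H - (\<Union>q\<in>P - {p}. block d q) = Inl ` H \<union> block d p"
    using p by (auto simp: column_labels_def block_def)
  have blocks: "block d q \<subseteq> column_labels d P H" if "q \<in> P" for q
    using that by (auto simp: column_labels_def block_def)
  have inj: "inj_on \<tau> (column_labels d P H)" and
    im: "\<tau> ` column_labels d P H = pinned_row_labels d I"
    using \<tau> by (auto simp: bij_betw_def)
  show ?thesis
  proof (cases "\<forall>k<d. \<tau> (Inr (p, k)) = Inr k")
    case True
    have "?D \<in> bracket_polynomials d H"
      unfolding bracket_polynomials_def
    proof (rule subalgebra_prod, fold bracket_polynomials_def)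
      fix q assume q: "q \<in> P - {p}"
      show "label_det (block d q) (\<lambda>i. M_pinned_entry indet p (\<tau> i)) \<in> bracket_polynomials d H"
        by (rule block_label_det[OF inj_on_subset[OF inj blocks] _ I])
          (use q im blocks in auto)
    qed
    moreover have "?E \<in> bracket_polynomials d H"
      unfolding rest bracket_polynomials_def
    proof (rule subalgebra_prod)
      fix c :: "'h + 'p \<times> nat" assume "c \<in> Inl ` H \<union> block d p"
      moreover have "M_pinned_entry indet p r (Inl h) \<in> {0, 1 :: 'h real_mpoly}"
        for h and r :: "('p \<times> 'h) + nat"
        by (cases r) auto
      ultimately have "M_pinned_entry indet p (\<tau> c) c \<in> {0, 1 :: 'h real_mpoly}"
        using True by (auto simp: block_def)
      then show "M_pinned_entry indet p (\<tau> c) c \<in> subalgebra_generated (brackets d H)"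
        by (auto intro: subalgebra_0 subalgebra_1)
    qed
    ultimately show ?thesis
      unfolding bracket_polynomials_def by (rule subalgebra_generated.mult)
  next
    case False
    then obtain k where k: "k < d" "\<tau> (Inr (p, k)) \<noteq> Inr k" by blast
    have "Inr k \<in> \<tau> ` column_labels d P H"
      using k im by (auto simp: pinned_row_labels_def)
    then obtain c where c: "c \<in> column_labels d P H" "\<tau> c = Inr k" by auto
    have zero: "M_pinned_entry indet p (\<tau> c) c' = (0 :: 'h real_mpoly)" if "c' \<noteq> Inr (p, k)" for c'
      using that c by simp
    have "?D * ?E = 0"
    proof (cases "c \<in> (\<Union>q\<in>P - {p}. block d q)")
      case True
      then obtain q where q: "q \<in> P - {p}" "c \<in> block d q" by blast
      have "label_det (block d q) (\<lambda>i. M_pinned_entry indet p (\<tau> i)) = (0 :: 'h real_mpoly)"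
        by (rule label_det_zero_row[of _ c]) (use q zero in \<open>auto simp: block_def\<close>)
      then have "?D = 0" using q fin by (intro prod_zero) auto
      then show ?thesis by simp
    next
      case False
      have "c \<noteq> Inr (p, k)" using c k by auto
      then have "M_pinned_entry indet p (\<tau> c) c = (0 :: 'h real_mpoly)" by (rule zero)
      moreover have "finite (column_labels d P H)" using fin by (simp add: column_labels_def)
      moreover have "c \<in> column_labels d P H - (\<Union>q\<in>P - {p}. block d q)"
        using False c by blast
      ultimately have "?E = 0"
        by (intro prod_zero bexI[of _ c] finite_Diff)
      then show ?thesis by simp
    qed
    then show ?thesis by (simp add: bracket_polynomials_def subalgebra_0)
  qed
qed

theorem corollary3p4:
  fixes d :: nat
    and P :: "'p set" and H :: "'h set" and I :: "('p \<times> 'h) set" and p :: 'p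
    and rs :: "(('p \<times> 'h) + nat) list" and cs :: "('h + 'p \<times> nat) list"
  assumes "d \<ge> 2"
    and "incidence_geometry P H I"
    and "card I + d = d * card P + card H"
    and "p \<in> P"
    and "enumerates rs (pinned_row_labels d I)"
    and "enumerates cs (column_labels d P H)"
  shows "det (M_pinned_matrix indet p rs cs) \<in> bracket_polynomials d H"
proof -
  let ?C = "column_labels d P H" and ?R = "pinned_row_labels d I" and ?Q = "P - {p}"
  let ?B = "block d :: 'p \<Rightarrow> ('h + 'p \<times> nat) set"
  have fin: "finite P" "finite H" and I: "I \<subseteq> P \<times> H"
    using assms(2) by (auto simp: incidence_geometry_def)
  then have finI: "finite I" using finite_subset by blast
  have finC: "finite ?C" using fin by (simp add: column_labels_def)
  define n where "n = length cs"
  have "length rs = card ?R" "length cs = card ?C"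
    using assms(5,6) distinct_card by (fastforce simp: enumerates_def)+
  then have len: "length rs = n"
    using assms(3) fin finI
    by (simp add: n_def column_labels_def pinned_row_labels_def card_Plus card_cartesian_product mult.commute)
  have cs: "bij_betw ((!) cs) {0..<n} ?C" and rs: "bij_betw ((!) rs) {0..<n} ?R"
    using assms(5,6) len
    by (auto simp: enumerates_def n_def atLeast0LessThan intro!: bij_betw_nth)
  \<comment> \<open>\<open>\<rho>\<close> identifies row labels with column labels by position; the count of incidences makes the
    matrix square.\<close>
  define \<rho> where "\<rho> = (!) rs \<circ> inv_into {0..<n} ((!) cs)"
  have \<rho>: "bij_betw \<rho> ?C ?R"
    unfolding \<rho>_def by (rule bij_betw_trans[OF bij_betw_inv_into[OF cs] rs])
  have \<rho>_cs: "\<rho> (cs ! i) = rs ! i" if "i < n" for i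
    using that cs by (simp add: \<rho>_def bij_betw_def)
  define A :: "_ \<Rightarrow> _ \<Rightarrow> 'h real_mpoly" where "A i = M_pinned_entry indet p (\<rho> i)" for i
  have "M_pinned_matrix indet p rs cs = mat n n (\<lambda>(i, j). A (cs ! i) (cs ! j))"
    unfolding M_pinned_matrix_def ordered_matrix_def
    by (rule eq_matI) (auto simp: len A_def \<rho>_cs simp flip: n_def)
  then have det: "det (M_pinned_matrix indet p rs cs) = label_det ?C A"
    using det_eq_label_det[OF cs, of A] by simp
  have "(\<Prod>q\<in>?Q. of_nat (fact (card (?B q)))) * label_det ?C A =
    (\<Sum>\<sigma> | \<sigma> permutes ?C. of_int (sign \<sigma>) *
      ((\<Prod>q\<in>?Q. label_det (?B q) (\<lambda>i. A (\<sigma> i))) *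
       (\<Prod>c\<in>?C - (\<Union>q\<in>?Q. ?B q). A (\<sigma> c) c)))"
    by (rule label_det_block_average)
      (use fin finC in \<open>auto simp: disjoint_family_on_def block_def column_labels_def\<close>)
  also have "\<dots> \<in> bracket_polynomials d H"
    unfolding bracket_polynomials_def
  proof (intro subalgebra_sum subalgebra_generated.mult[OF subalgebra_of_int],
      fold bracket_polynomials_def)
    fix \<sigma> assume "\<sigma> \<in> {\<sigma>. \<sigma> permutes ?C}"
    then have "bij_betw (\<rho> \<circ> \<sigma>) ?C ?R"
      using permutes_imp_bij \<rho> bij_betw_trans by blast
    from expansion_term_bracket_polynomial[OF this fin I assms(4)]
    show "(\<Prod>q\<in>?Q. label_det (?B q) (\<lambda>i. A (\<sigma> i))) *
       (\<Prod>c\<in>?C - (\<Union>q\<in>?Q. ?B q). A (\<sigma> c) c) \<in> bracket_polynomials d H"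
      by (simp add: A_def)
  qed
  finally have "of_nat (\<Prod>q\<in>?Q. fact (card (?B q))) * label_det ?C A
      \<in> bracket_polynomials d H"
    by simp
  then show ?thesis
    unfolding det bracket_polynomials_def
    by (rule subalgebra_cancel_of_nat) (simp add: prod_pos)
qed

end
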